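(* Let $\phi:\mathbb{R}^n\to\overline{\mathbb{R}}$ be a proper lower semicontinuous function bounded from below, let $a,b>0$, and let $\{x^k\}_{k\ge 0}\subset\mathbb{R}^n$ be a sequence satisfying the sufficient decrease condition $$\phi(x^{k+1})+a\|x^{k+1}-x^k\|^2\le\phi(x^k)\quad\text{for each }k\in\mathbb{N},$$ and at least one of the following two conditions: (relative error) for each $k\in\mathbb{N}$ there exists $w^{k+1}\in\partial\phi(x^{k+1})$ with $\|w^{k+1}\|\le b\|x^{k+1}-x^k\|$; (modified relative error) for each $k\in\mathbb{N}$ there exists $w^{k}\in\partial\phi(x^{k})$ with $\|w^{k}\|\le b\|x^{k+1}-x^k\|$. Let $\bar x\in\mathrm{dom}\,\phi$ be an accumulation point of $\{x^k\}$ such that, for some subsequence $\{x^{k_j}\}$, $x^{k_j}\to\bar x$ and $\phi(x^{k_j})\to\phi(\bar x)$ as $j\to\infty$. If $\phi$ satisfies the basic PLK condition at $\bar x$, then $$\sum_{k=0}^{\infty}\|x^k-x^{k+1}\|<\infty,$$ the sequence $\{x^k\}$ converges to $\bar x$ as $k\to\infty$, and $\bar x$ is an M-stationary point of $\phi$, i.e., $0\in\partial\phi(\bar x)$.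
   Context: $\overline{\mathbb{R}}:=\mathbb{R}\cup\{\infty\}$, $\mathrm{dom}\,\phi:=\{x\mid\phi(x)<\infty\}$, $\mathbb{N}:=\{1,2,\ldots\}$, $\mathrm{dist}(0,\emptyset):=\infty$. For $x\in\mathrm{dom}\,\phi$, the regular subdifferential $\widehat\partial\phi(x)$ is the set of $v\in\mathbb{R}^n$ with $\liminf_{u\to x,\,u\ne x}\frac{\phi(u)-\phi(x)-\langle v,u-x\rangle}{\|u-x\|}\ge 0$, and the limiting (Mordukhovich) subdifferential is $$\partial\phi(x):=\{v\in\mathbb{R}^n\mid \exists\, x_k\to x,\ \phi(x_k)\to\phi(x),\ v_k\in\widehat\partial\phi(x_k),\ v_k\to v\};$$ both sets are empty if $x\notin\mathrm{dom}\,\phi$. Basic PLK (Polyak-\L ojasiewicz-Kurdyka) condition at $\bar x\in\mathrm{dom}\,\phi$: there exist $\eta\in(0,\infty)$, a neighborhood $U$ of $\bar x$, and a concave continuous function $\varphi:[0,\eta]\to[0,\infty)$ with $\varphi(0)=0$, $\varphi\in C^1(0,\eta)$, $\varphi'(s)>0$ for all $s\in(0,\eta)$, such that $$\varphi'\big(\phi(x)-\phi(\bar x)\big)\,\mathrm{dist}\big(0,\partial\phi(x)\big)\ge 1\quad\text{for all }x\in U\text{ with }\phi(\bar x)<\phi(x)<\phi(\bar x)+\eta.$$ *)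

theory Defs
  imports "HOL-Analysis.Analysis"
begin

(* Functions with values in the reals together with infinity are modelled as ereal-valued
   functions; the value -\<infinity> is excluded by proper_fun. *)

definition effective_domain :: "('a \<Rightarrow> ereal) \<Rightarrow> 'a set" where
  "effective_domain \<phi> = {x. \<phi> x < \<infinity>}"

definition proper_fun :: "('a \<Rightarrow> ereal) \<Rightarrow> bool" where
  "proper_fun \<phi> \<longleftrightarrow> (\<forall>x. \<phi> x \<noteq> -\<infinity>) \<and> effective_domain \<phi> \<noteq> {}"

definition lower_semicontinuous :: "('a::topological_space \<Rightarrow> ereal) \<Rightarrow> bool" where
  "lower_semicontinuous \<phi> \<longleftrightarrow> (\<forall>x. \<phi> x \<le> Liminf (at x) \<phi>)"

definition bounded_from_below :: "('a \<Rightarrow> ereal) \<Rightarrow> bool" where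
  "bounded_from_below \<phi> \<longleftrightarrow> (\<exists>m::real. \<forall>x. ereal m \<le> \<phi> x)"

definition regular_subdifferential :: "('a::euclidean_space \<Rightarrow> ereal) \<Rightarrow> 'a \<Rightarrow> 'a set" where
  "regular_subdifferential \<phi> x =
    {v. x \<in> effective_domain \<phi> \<and>
        0 \<le> Liminf (at x) (\<lambda>u. (\<phi> u - \<phi> x - ereal (v \<bullet> (u - x))) / ereal (norm (u - x)))}"

definition limiting_subdifferential :: "('a::euclidean_space \<Rightarrow> ereal) \<Rightarrow> 'a \<Rightarrow> 'a set" where
  "limiting_subdifferential \<phi> x =
    {v. x \<in> effective_domain \<phi> \<and>
        (\<exists>xs vs. xs \<longlonglongrightarrow> x \<and> (\<lambda>k. \<phi> (xs k)) \<longlonglongrightarrow> \<phi> x \<and>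
                 (\<forall>k. vs k \<in> regular_subdifferential \<phi> (xs k)) \<and> vs \<longlonglongrightarrow> v)}"

(* Extended-real valued so that the distance to the empty set is \<infinity>;
   the library's infdist and setdist give 0 there. *)
definition ext_dist :: "'a::metric_space \<Rightarrow> 'a set \<Rightarrow> ereal" where
  "ext_dist x S = (INF y\<in>S. ereal (dist x y))"

definition desingularizing :: "real \<Rightarrow> (real \<Rightarrow> real) \<Rightarrow> bool" where
  "desingularizing \<eta> \<psi> \<longleftrightarrow>
     \<psi> \<in> {0..\<eta>} \<rightarrow> {0..} \<and> concave_on {0..\<eta>} \<psi> \<and> continuous_on {0..\<eta>} \<psi> \<and> \<psi> 0 = 0 \<and>
     \<psi> C1_differentiable_on {0<..<\<eta>} \<and> (\<forall>s\<in>{0<..<\<eta>}. 0 < deriv \<psi> s)"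

(* real_of_ereal is applied only where \<phi> x - \<phi> xbar is finite: \<phi> xbar < \<infinity>, the inequalities
   on \<phi> x, and properness of \<phi> ensure this. *)
definition basic_PLK :: "('a::euclidean_space \<Rightarrow> ereal) \<Rightarrow> 'a \<Rightarrow> bool" where
  "basic_PLK \<phi> xbar \<longleftrightarrow>
     xbar \<in> effective_domain \<phi> \<and>
     (\<exists>\<eta>>0. \<exists>U \<psi>. xbar \<in> interior U \<and> desingularizing \<eta> \<psi> \<and>
        (\<forall>x\<in>U. \<phi> xbar < \<phi> x \<and> \<phi> x < \<phi> xbar + ereal \<eta> \<longrightarrow>
           1 \<le> ereal (deriv \<psi> (real_of_ereal (\<phi> x - \<phi> xbar)))
                 * ext_dist 0 (limiting_subdifferential \<phi> x)))"

definition M_stationary :: "('a::euclidean_space \<Rightarrow> ereal) \<Rightarrow> 'a \<Rightarrow> bool" where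
  "M_stationary \<phi> x \<longleftrightarrow> 0 \<in> limiting_subdifferential \<phi> x"

(* The descent conditions are imposed for k \<ge> 1 only, although sequences start at index 0. *)

definition sufficient_decrease ::
    "('a::euclidean_space \<Rightarrow> ereal) \<Rightarrow> real \<Rightarrow> (nat \<Rightarrow> 'a) \<Rightarrow> bool" where
  "sufficient_decrease \<phi> a x \<longleftrightarrow>
     (\<forall>k\<ge>1. \<phi> (x (k + 1)) + ereal (a * (norm (x (k + 1) - x k))\<^sup>2) \<le> \<phi> (x k))"

definition relative_error ::
    "('a::euclidean_space \<Rightarrow> ereal) \<Rightarrow> real \<Rightarrow> (nat \<Rightarrow> 'a) \<Rightarrow> bool" where
  "relative_error \<phi> b x \<longleftrightarrow>
     (\<forall>k\<ge>1. \<exists>w\<in>limiting_subdifferential \<phi> (x (k + 1)). norm w \<le> b * norm (x (k + 1) - x k))"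

definition modified_relative_error ::
    "('a::euclidean_space \<Rightarrow> ereal) \<Rightarrow> real \<Rightarrow> (nat \<Rightarrow> 'a) \<Rightarrow> bool" where
  "modified_relative_error \<phi> b x \<longleftrightarrow>
     (\<forall>k\<ge>1. \<exists>w\<in>limiting_subdifferential \<phi> (x k). norm w \<le> b * norm (x (k + 1) - x k))"

end

theory Submission
  imports Defs
begin

text \<open>
  The desingularizing function \<open>\<psi>\<close> turns the decrease of \<open>\<phi>\<close> into a bound on the length of the
  trajectory. Write \<open>d\<^sub>k = \<parallel>x\<^sub>k\<^sub>+\<^sub>1 - x\<^sub>k\<parallel>\<close> and \<open>s\<^sub>k = \<phi>(x\<^sub>k) - \<phi>(xbar)\<close>, which decreases to \<open>0\<close>.
  By concavity the drop \<open>\<psi>(s\<^sub>k) - \<psi>(s\<^sub>k\<^sub>+\<^sub>1)\<close> is at least \<open>\<psi>'(s\<^sub>k) (s\<^sub>k - s\<^sub>k\<^sub>+\<^sub>1) \<ge> \<psi>'(s\<^sub>k) a d\<^sub>k\<^sup>2\<close>,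
  and the PLK inequality, applied to a subgradient of norm at most \<open>b \<delta>\<close>, bounds \<open>\<psi>'(s\<^sub>k)\<close> below by
  \<open>1 / (b \<delta>)\<close>. Hence \<open>a d\<^sub>k\<^sup>2 \<le> b \<delta> (\<psi>(s\<^sub>k) - \<psi>(s\<^sub>k\<^sub>+\<^sub>1))\<close> (lemma \<open>PLK_decrease\<close>), where \<open>\<delta>\<close> is
  \<open>d\<^sub>k\<^sub>-\<^sub>1\<close> under the relative error condition and \<open>d\<^sub>k\<close> under the modified one. In both cases
  \<open>2 d\<^sub>k \<le> d\<^sub>k\<^sub>-\<^sub>1 + 2 (b/a) (\<psi>(s\<^sub>k) - \<psi>(s\<^sub>k\<^sub>+\<^sub>1))\<close> (lemma \<open>step_le_of_quadratic\<close>), and from here on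
  the two error conditions need not be distinguished.

  If some \<open>s\<^sub>k\<close> is \<open>0\<close>, the sequence is constant from there on. Otherwise the recursion
  telescopes, but it is available only while the iterates stay in the neighbourhood
  where the PLK inequality holds. If it is started at an iterate that is close enough to \<open>xbar\<close> and
  has small \<open>d\<^sub>k\<^sub>-\<^sub>1\<close> and \<open>\<psi>(s\<^sub>k)\<close>, the resulting bound on the length of the path is what keeps the
  iterates inside (lemma \<open>summable_steps_of_local_recursion\<close>). So the path has finite length and
  converges, necessarily to its accumulation point \<open>xbar\<close>.

  The subgradients tend to \<open>0\<close> with \<open>d\<^sub>k\<close>, and the limiting subdifferential is closed under limits
  along which the values of \<open>\<phi>\<close> converge too (lemma \<open>limiting_subdifferential_limit\<close>); this gives
  stationarity.
\<close>

section \<open>Closedness of the limiting subdifferential\<close>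

text \<open>
  The defining sequences of the limiting subdifferential converge jointly in point, value and
  subgradient. Reading them as one sequence in the product space, which is first countable, replaces
  the diagonal argument for closedness by the idempotence of the closure.
\<close>

lemma limiting_subdifferential_iff_closure:
  "v \<in> limiting_subdifferential \<phi> x \<longleftrightarrow>
     x \<in> effective_domain \<phi> \<and>
     (x, \<phi> x, v) \<in> closure {(y, \<phi> y, u) | y u. u \<in> regular_subdifferential \<phi> y}"
    (is "_ \<longleftrightarrow> _ \<and> _ \<in> closure ?G")
proof -
  have "(x, \<phi> x, v) \<in> closure ?G" if "xs \<longlonglongrightarrow> x" "(\<lambda>k. \<phi> (xs k)) \<longlonglongrightarrow> \<phi> x"
    "\<forall>k. vs k \<in> regular_subdifferential \<phi> (xs k)" "vs \<longlonglongrightarrow> v" for xs vs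
    unfolding closure_sequential
    by (rule exI[of _ "\<lambda>k. (xs k, \<phi> (xs k), vs k)"]) (use that in \<open>auto intro!: tendsto_Pair\<close>)
  moreover have "\<exists>xs vs. xs \<longlonglongrightarrow> x \<and> (\<lambda>k. \<phi> (xs k)) \<longlonglongrightarrow> \<phi> x \<and>
      (\<forall>k. vs k \<in> regular_subdifferential \<phi> (xs k)) \<and> vs \<longlonglongrightarrow> v"
    if "(x, \<phi> x, v) \<in> closure ?G"
  proof -
    obtain g where g: "\<And>k. g k \<in> ?G" and lim: "g \<longlonglongrightarrow> (x, \<phi> x, v)"
      using \<open>(x, \<phi> x, v) \<in> closure ?G\<close> unfolding closure_sequential by blast
    have val: "fst (snd (g k)) = \<phi> (fst (g k))"
      and reg: "snd (snd (g k)) \<in> regular_subdifferential \<phi> (fst (g k))" for k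
      using g[of k] by auto
    show ?thesis
      using tendsto_fst[OF lim] tendsto_fst[OF tendsto_snd[OF lim]]
        tendsto_snd[OF tendsto_snd[OF lim]] reg
      by (intro exI[of _ "\<lambda>k. fst (g k)"] exI[of _ "\<lambda>k. snd (snd (g k))"]) (simp add: val)
  qed
  ultimately show ?thesis
    unfolding limiting_subdifferential_def by blast
qed

lemma limiting_subdifferential_limit:
  assumes "y \<in> effective_domain \<phi>"
    and "xs \<longlonglongrightarrow> y" and "(\<lambda>k. \<phi> (xs k)) \<longlonglongrightarrow> \<phi> y" and "ws \<longlonglongrightarrow> w"
    and "\<And>k. ws k \<in> limiting_subdifferential \<phi> (xs k)"
  shows "w \<in> limiting_subdifferential \<phi> y"
proof -
  let ?G = "{(z, \<phi> z, u) | z u. u \<in> regular_subdifferential \<phi> z}"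
  have "(xs k, \<phi> (xs k), ws k) \<in> closure ?G" for k
    using assms(5)[of k] unfolding limiting_subdifferential_iff_closure by blast
  moreover have "(\<lambda>k. (xs k, \<phi> (xs k), ws k)) \<longlonglongrightarrow> (y, \<phi> y, w)"
    by (intro tendsto_Pair assms)
  ultimately have "(y, \<phi> y, w) \<in> closure ?G"
    by (rule closed_sequentially[OF closed_closure])
  then show ?thesis
    using assms(1) unfolding limiting_subdifferential_iff_closure by blast
qed

section \<open>The estimate for a single step\<close>

lemma ext_dist_le:
  assumes "y \<in> S"
  shows "ext_dist x S \<le> ereal (dist x y)"
  unfolding ext_dist_def by (rule INF_lower[OF assms])

lemma desingularizing_above_tangent:
  assumes "desingularizing \<eta> \<psi>" and "0 < s" "s < \<eta>" and "0 \<le> t" "t \<le> \<eta>"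
  shows "deriv \<psi> s * (s - t) \<le> \<psi> s - \<psi> t"
proof -
  have "\<psi> differentiable (at s)"
    using assms(1-3) by (auto simp: desingularizing_def C1_differentiable_on_eq)
  then have "(\<psi> has_field_derivative deriv \<psi> s) (at s)"
    by (simp add: DERIV_deriv_iff_real_differentiable)
  then have "((\<lambda>u. - \<psi> u) has_field_derivative - deriv \<psi> s) (at s within {0..\<eta>})"
    by (intro DERIV_minus) (rule has_field_derivative_at_within)
  moreover have "convex_on {0..\<eta>} (\<lambda>u. - \<psi> u)"
    using assms(1) by (simp add: desingularizing_def concave_on_def)
  ultimately have "- deriv \<psi> s * (t - s) \<le> - \<psi> t - - \<psi> s"
    using assms(2-5) by (intro convex_on_imp_above_tangent[where A = "{0..\<eta>}"]) auto
  then show ?thesis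
    by (simp add: algebra_simps)
qed

text \<open>
  The reason is \<open>\<psi> s - \<psi> t \<ge> \<psi>'(s) (s - t)\<close> together with \<open>1 \<le> \<psi>'(s) b \<delta>\<close>. Keeping \<open>\<delta>\<close> as a
  factor, instead of dividing by it, avoids a separate argument that \<open>\<delta>\<close> is nonzero.
\<close>

lemma PLK_decrease:
  assumes "desingularizing \<eta> \<psi>" and "0 < s" "s < \<eta>" and "0 \<le> t"
    and PLK: "1 \<le> ereal (deriv \<psi> s) * ext_dist 0 S"
    and "w \<in> S" and "norm w \<le> b * \<delta>"
    and "0 < a" and decrease: "t + a * d\<^sup>2 \<le> s"
  shows "\<psi> t \<le> \<psi> s" and "a * d\<^sup>2 \<le> b * \<delta> * (\<psi> s - \<psi> t)"
proof -
  let ?D = "deriv \<psi> s"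
  have "0 < ?D"
    using assms(1-3) by (auto simp: desingularizing_def)
  have "0 \<le> a * d\<^sup>2"
    using \<open>0 < a\<close> by simp
  have "t \<le> \<eta>"
    using \<open>0 \<le> a * d\<^sup>2\<close> decrease \<open>s < \<eta>\<close> by linarith
  have "?D * (a * d\<^sup>2) \<le> ?D * (s - t)"
    using \<open>0 < ?D\<close> decrease by (intro mult_left_mono) auto
  also have "\<dots> \<le> \<psi> s - \<psi> t"
    using desingularizing_above_tangent[OF assms(1-4) \<open>t \<le> \<eta>\<close>] .
  finally have drop: "?D * (a * d\<^sup>2) \<le> \<psi> s - \<psi> t" .
  moreover have "0 \<le> ?D * (a * d\<^sup>2)"
    using \<open>0 < ?D\<close> \<open>0 \<le> a * d\<^sup>2\<close> by simp
  ultimately show "\<psi> t \<le> \<psi> s"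
    by linarith
  have "ereal ?D * ext_dist 0 S \<le> ereal ?D * ereal (dist 0 w)"
    using ext_dist_le[OF \<open>w \<in> S\<close>, of 0] \<open>0 < ?D\<close> by (intro ereal_mult_left_mono) auto
  then have "1 \<le> ereal ?D * ereal (dist 0 w)"
    using PLK order_trans by blast
  then have "1 \<le> ?D * norm w"
    by (simp add: one_ereal_def)
  also have "\<dots> \<le> ?D * (b * \<delta>)"
    using \<open>0 < ?D\<close> \<open>norm w \<le> b * \<delta>\<close> by (intro mult_left_mono) auto
  finally have "a * d\<^sup>2 \<le> (?D * (b * \<delta>)) * (a * d\<^sup>2)"
    using \<open>0 \<le> a * d\<^sup>2\<close> mult_right_mono[of 1 "?D * (b * \<delta>)" "a * d\<^sup>2"] by simp
  also have "\<dots> = (b * \<delta>) * (?D * (a * d\<^sup>2))"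
    by (simp add: algebra_simps)
  also have "\<dots> \<le> (b * \<delta>) * (\<psi> s - \<psi> t)"
    using drop \<open>norm w \<le> b * \<delta>\<close> norm_ge_zero[of w] by (intro mult_left_mono) linarith+
  finally show "a * d\<^sup>2 \<le> b * \<delta> * (\<psi> s - \<psi> t)" .
qed

text \<open>
  For \<open>\<delta> = e\<close> this is the inequality of arithmetic and geometric means; for \<open>\<delta> = d\<close> a factor \<open>d\<close>
  cancels. The common constant \<open>2 b / a\<close> is twice what the first case gives, so that
  both error conditions lead to one recursion.
\<close>

lemma step_le_of_quadratic:
  fixes a b d e \<Delta> :: real
  assumes "0 < a" "0 < b" and "0 \<le> d" "0 \<le> e" "0 \<le> \<Delta>"
    and "\<delta> = e \<or> \<delta> = d" and "a * d\<^sup>2 \<le> b * \<delta> * \<Delta>"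
  shows "2 * d \<le> e + 2 * (b / a) * \<Delta>"
proof -
  define c where "c = (b / a) * \<Delta>"
  have "0 \<le> c"
    using assms(1,2,5) by (simp add: c_def)
  have quad: "d\<^sup>2 \<le> \<delta> * c"
    using \<open>0 < a\<close> assms(7) by (simp add: c_def field_simps)
  have "2 * d \<le> e + 2 * c"
  proof (cases "\<delta> = e")
    case True
    have "(2 * d)\<^sup>2 = 4 * d\<^sup>2"
      by (simp add: power_mult_distrib)
    also have "\<dots> \<le> 4 * (e * c)"
      using quad True by simp
    also have "\<dots> \<le> 4 * (e * c) + (e - c)\<^sup>2"
      by simp
    also have "\<dots> = (e + c)\<^sup>2"
      by (simp add: power2_eq_square algebra_simps)
    finally have "(2 * d)\<^sup>2 \<le> (e + c)\<^sup>2" .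
    moreover have "0 \<le> e + c"
      using \<open>0 \<le> e\<close> \<open>0 \<le> c\<close> by simp
    ultimately have "2 * d \<le> e + c"
      by (rule power2_le_imp_le)
    then show ?thesis
      using \<open>0 \<le> c\<close> by simp
  next
    case False
    then have "d * d \<le> d * c"
      using quad assms(6) by (simp add: power2_eq_square)
    then have "d \<le> c"
      using \<open>0 \<le> d\<close> \<open>0 \<le> c\<close> by (cases "d = 0") auto
    then show ?thesis
      using \<open>0 \<le> e\<close> by simp
  qed
  then show ?thesis
    by (simp add: c_def)
qed

section \<open>Trajectories of finite length\<close>

text \<open>
  The recursion is assumed only at iterates inside the ball, so confinement and the length bound are
  proved together. The bound on the length also carries the last step \<open>d n\<close> and the remaining budget
  \<open>p n\<close>: together they pay for \<open>2 * d (Suc n)\<close>, of which one copy lengthens the path and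
  the other becomes the new last step, so that the induction closes without loss.
\<close>

lemma summable_steps_of_local_recursion:
  fixes x :: "nat \<Rightarrow> 'a::real_normed_vector" and p :: "nat \<Rightarrow> real"
  defines "d \<equiv> \<lambda>n. norm (x (Suc n) - x n)"
  assumes recursion: "\<And>n. x (Suc n) \<in> ball z \<rho> \<Longrightarrow> 2 * d (Suc n) \<le> d n + p n - p (Suc n)"
    and p_nonneg: "\<And>n. 0 \<le> p n"
    and start: "dist z (x 1) + d 0 + p 0 < \<rho>"
  shows "summable d"
proof -
  have path: "dist z (x (Suc n)) \<le> dist z (x 1) + (\<Sum>k<n. d (Suc k))" for n
  proof (induction n)
    case (Suc n)
    have "dist z (x (Suc (Suc n))) \<le> dist z (x (Suc n)) + d (Suc n)"
      using dist_triangle[of z "x (Suc (Suc n))" "x (Suc n)"]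
      by (simp add: d_def dist_norm norm_minus_commute)
    with Suc show ?case by simp
  qed simp
  have bound: "(\<Sum>k<n. d (Suc k)) + d n + p n \<le> d 0 + p 0" for n
  proof (induction n)
    case (Suc n)
    have "0 \<le> d n"
      by (simp add: d_def)
    then have "x (Suc n) \<in> ball z \<rho>"
      using path[of n] Suc p_nonneg[of n] start by simp
    from recursion[OF this] Suc show ?case by simp
  qed simp
  have "summable (\<lambda>k. d (Suc k))"
  proof (rule summableI_nonneg_bounded)
    show "0 \<le> d (Suc n)" for n
      by (simp add: d_def)
    show "(\<Sum>k<n. d (Suc k)) \<le> d 0 + p 0" for n
      using bound[of n] p_nonneg[of n] norm_ge_zero[of "x (Suc n) - x n"]
      unfolding d_def by linarith
  qed
  then show ?thesis
    by (simp add: summable_Suc_iff)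
qed

lemma convergent_if_summable_steps:
  fixes x :: "nat \<Rightarrow> 'a::banach"
  assumes "summable (\<lambda>k. norm (x (Suc k) - x k))"
  shows "convergent x"
proof -
  have "summable (\<lambda>k. x (Suc k) - x k)"
    using assms by (rule summable_norm_cancel)
  then have "convergent (\<lambda>n. x n - x 0)"
    by (simp add: summable_iff_convergent sum_lessThan_telescope)
  then have "convergent (\<lambda>n. (x n - x 0) + x 0)"
    by (intro convergent_add convergent_const)
  then show ?thesis
    by simp
qed

lemma decseq_subseq_limit:
  fixes f :: "nat \<Rightarrow> 'a::linorder_topology"
  assumes "decseq f" and "strict_mono r" and "(\<lambda>j. f (r j)) \<longlonglongrightarrow> l"
  shows "f \<longlonglongrightarrow> l" and "\<And>n. l \<le> f n"
proof -
  show ge: "l \<le> f n" for n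
  proof (rule LIMSEQ_le_const2[OF assms(3)])
    have "f (r j) \<le> f n" if "n \<le> j" for j
      using decseqD[OF assms(1)] seq_suble[OF assms(2), of j] that by simp
    then show "\<exists>N. \<forall>j\<ge>N. f (r j) \<le> f n"
      by blast
  qed
  show "f \<longlonglongrightarrow> l"
  proof (rule order_tendstoI)
    fix c assume "l < c"
    then obtain j where "f (r j) < c"
      using order_tendstoD(2)[OF assms(3)] eventually_happens by fastforce
    then have "f n < c" if "r j \<le> n" for n
      using decseqD[OF assms(1) that] by simp
    then show "\<forall>\<^sub>F n in sequentially. f n < c"
      by (auto simp: eventually_sequentially)
  next
    fix c assume "c < l"
    then show "\<forall>\<^sub>F n in sequentially. c < f n"
      using less_le_trans[OF _ ge] by simp
  qed
qed

section \<open>Convergence of descent sequences\<close>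

text \<open>
  The length argument for a tail of the sequence, with the values of \<open>\<phi>\<close> shifted so that the
  value at \<open>xbar\<close> becomes \<open>0\<close>. Values that reach \<open>0\<close> stop the sequence and are outside the scope
  of the PLK inequality, hence the case distinction.
\<close>

lemma descent_summable_steps:
  fixes y :: "nat \<Rightarrow> 'a::euclidean_space" and s :: "nat \<Rightarrow> real"
  defines "d \<equiv> \<lambda>n. norm (y (Suc n) - y n)"
  assumes PLK: "basic_PLK \<phi> xbar" and "0 < a" "0 < b"
    and level_bar: "\<phi> xbar = ereal m" and level: "\<And>n. \<phi> (y n) = ereal (m + s n)"
    and decrease: "\<And>n. s (Suc n) + a * (d n)\<^sup>2 \<le> s n"
    and s_nonneg: "\<And>n. 0 \<le> s n" and "s \<longlonglongrightarrow> 0"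
    and subgradient: "\<And>n. \<exists>w\<in>limiting_subdifferential \<phi> (y (Suc n)).
          \<exists>\<delta>. (\<delta> = d n \<or> \<delta> = d (Suc n)) \<and> norm w \<le> b * \<delta>"
    and "strict_mono q" and "(\<lambda>j. y (q j)) \<longlonglongrightarrow> xbar"
  shows "summable d"
proof -
  have d_nonneg: "0 \<le> d n" for n
    by (simp add: d_def)
  have s_Suc_le: "s (Suc n) \<le> s n" for n
  proof -
    have "0 \<le> a * (d n)\<^sup>2"
      using \<open>0 < a\<close> by simp
    with decrease[of n] show ?thesis by linarith
  qed
  then have "decseq s"
    by (rule decseq_SucI)
  show ?thesis
  proof (cases "\<exists>N. s N = 0")
    case True
    then obtain N where "s N = 0" ..
    have "d n = 0" if "N \<le> n" for n
    proof -
      have "s n \<le> 0"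
        using decseqD[OF \<open>decseq s\<close> that] \<open>s N = 0\<close> by simp
      then have "a * (d n)\<^sup>2 \<le> 0"
        using decrease[of n] s_nonneg[of "Suc n"] by linarith
      then show ?thesis
        using \<open>0 < a\<close> by (simp add: mult_le_0_iff)
    qed
    then show ?thesis
      by (intro summable_finite[of "{..<N}"]) (auto simp: not_less)
  next
    case False
    then have s_pos: "0 < s n" for n
      using s_nonneg[of n] by (metis order_le_less)
    obtain \<eta> U \<psi> where "0 < \<eta>" and "xbar \<in> interior U" and \<psi>: "desingularizing \<eta> \<psi>"
      and ineq: "\<And>u. \<lbrakk>u \<in> U; \<phi> xbar < \<phi> u; \<phi> u < \<phi> xbar + ereal \<eta>\<rbrakk> \<Longrightarrow>
           1 \<le> ereal (deriv \<psi> (real_of_ereal (\<phi> u - \<phi> xbar)))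
                 * ext_dist 0 (limiting_subdifferential \<phi> u)"
      using PLK unfolding basic_PLK_def by blast
    obtain \<rho> where "0 < \<rho>" and "ball xbar \<rho> \<subseteq> U"
      using \<open>xbar \<in> interior U\<close> by (auto simp: mem_interior)
    define p where "p n = 2 * (b / a) * \<psi> (s (Suc n))" for n

    have recursion: "2 * d (Suc n) \<le> d n + p n - p (Suc n)"
      if "y (Suc n) \<in> ball xbar \<rho>" and "s (Suc n) < \<eta>" for n
    proof -
      obtain w \<delta> where w: "w \<in> limiting_subdifferential \<phi> (y (Suc n))" "norm w \<le> b * \<delta>"
        and \<delta>: "\<delta> = d n \<or> \<delta> = d (Suc n)"
        using subgradient by blast
      have "1 \<le> ereal (deriv \<psi> (s (Suc n)))
          * ext_dist 0 (limiting_subdifferential \<phi> (y (Suc n)))"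
        using ineq[of "y (Suc n)"] that \<open>ball xbar \<rho> \<subseteq> U\<close> s_pos[of "Suc n"]
        by (auto simp: level level_bar)
      note drop = PLK_decrease[OF \<psi> s_pos \<open>s (Suc n) < \<eta>\<close> s_nonneg this w \<open>0 < a\<close> decrease]
      have "2 * d (Suc n) \<le> d n + 2 * (b / a) * (\<psi> (s (Suc n)) - \<psi> (s (Suc (Suc n))))"
        using drop \<delta> by (intro step_le_of_quadratic[OF \<open>0 < a\<close> \<open>0 < b\<close>]) (auto simp: d_nonneg)
      then show ?thesis
        by (simp add: p_def algebra_simps)
    qed

    have "(\<lambda>n. s n - s (Suc n)) \<longlonglongrightarrow> 0"
      using tendsto_diff[OF \<open>s \<longlonglongrightarrow> 0\<close> LIMSEQ_Suc[OF \<open>s \<longlonglongrightarrow> 0\<close>]] by simp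
    then have quotient: "(\<lambda>n. (s n - s (Suc n)) / a) \<longlonglongrightarrow> 0"
      using tendsto_divide_zero by blast
    have "norm ((d n)\<^sup>2) \<le> (s n - s (Suc n)) / a" for n
      using decrease[of n] \<open>0 < a\<close> by (simp add: field_simps)
    then have "(\<lambda>n. (d n)\<^sup>2) \<longlonglongrightarrow> 0"
      by (intro Lim_null_comparison[OF always_eventually quotient] allI)
    then have "d \<longlonglongrightarrow> 0"
      by simp

    have s_small: "\<forall>\<^sub>F n in sequentially. s n < \<eta>"
      using order_tendstoD(2)[OF \<open>s \<longlonglongrightarrow> 0\<close> \<open>0 < \<eta>\<close>] .
    have "\<forall>\<^sub>F n in sequentially. s n \<in> {0..\<eta>}"
      using s_small by eventually_elim (use s_nonneg in \<open>auto simp: less_imp_le\<close>)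
    moreover have "continuous_on {0..\<eta>} \<psi>" and "0 \<in> {0..\<eta>}"
      using \<psi> \<open>0 < \<eta>\<close> by (auto simp: desingularizing_def)
    ultimately have "(\<lambda>n. \<psi> (s n)) \<longlonglongrightarrow> \<psi> 0"
      using continuous_on_tendsto_compose[of "{0..\<eta>}" \<psi> s 0 sequentially] \<open>s \<longlonglongrightarrow> 0\<close>
      by blast
    then have "(\<lambda>n. 2 * (b / a) * \<psi> (s n)) \<longlonglongrightarrow> 2 * (b / a) * \<psi> 0"
      by (rule tendsto_mult_left)
    then have "(\<lambda>n. 2 * (b / a) * \<psi> (s n)) \<longlonglongrightarrow> 0"
      using \<psi> by (simp add: desingularizing_def)

    \<comment> \<open>A starting iterate close to \<open>xbar\<close> comes from the subsequence. The index is shifted by one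
      because the step that precedes this iterate enters the estimate.\<close>
    have "(\<lambda>j. dist xbar (y (q j)) + d (q j - 1) + 2 * (b / a) * \<psi> (s (q j))) \<longlonglongrightarrow> 0 + 0 + 0"
    proof (intro tendsto_add)
      show "(\<lambda>j. dist xbar (y (q j))) \<longlonglongrightarrow> 0"
        using tendsto_dist[OF tendsto_const \<open>(\<lambda>j. y (q j)) \<longlonglongrightarrow> xbar\<close>, of xbar] by simp
      have q: "filterlim q at_top sequentially"
        using \<open>strict_mono q\<close> by (rule filterlim_subseq)
      show "(\<lambda>j. d (q j - 1)) \<longlonglongrightarrow> 0"
        using filterlim_compose[OF \<open>d \<longlonglongrightarrow> 0\<close>
            filterlim_compose[OF filterlim_minus_const_nat_at_top q]] .
      show "(\<lambda>j. 2 * (b / a) * \<psi> (s (q j))) \<longlonglongrightarrow> 0"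
        using filterlim_compose[OF \<open>(\<lambda>n. 2 * (b / a) * \<psi> (s n)) \<longlonglongrightarrow> 0\<close> q] .
    qed
    then have "\<forall>\<^sub>F j in sequentially.
        dist xbar (y (q j)) + d (q j - 1) + 2 * (b / a) * \<psi> (s (q j)) < \<rho>"
      using \<open>0 < \<rho>\<close> by (intro order_tendstoD(2)) auto
    moreover have "\<forall>\<^sub>F j in sequentially. s (q j) < \<eta>"
      using eventually_subseq[OF \<open>strict_mono q\<close> s_small] .
    moreover have "\<forall>\<^sub>F j in sequentially. 0 < q j"
      using eventually_subseq[OF \<open>strict_mono q\<close> eventually_gt_at_top[of 0]] .
    ultimately have "\<forall>\<^sub>F j in sequentially.
        dist xbar (y (q j)) + d (q j - 1) + 2 * (b / a) * \<psi> (s (q j)) < \<rho> \<and>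
        s (q j) < \<eta> \<and> 0 < q j"
      by (intro eventually_conj)
    then obtain j where
      j: "dist xbar (y (q j)) + d (q j - 1) + 2 * (b / a) * \<psi> (s (q j)) < \<rho>"
        "s (q j) < \<eta>" "0 < q j"
      using eventually_happens by fastforce
    define K where "K = q j - 1"
    have K: "Suc K = q j"
      using j(3) by (simp add: K_def)
    have s_lt: "s (Suc (n + K)) < \<eta>" for n
      using decseqD[OF \<open>decseq s\<close>, of "Suc K" "Suc (n + K)"] j(2) by (simp flip: K)
    have "summable (\<lambda>n. norm (y (Suc n + K) - y (n + K)))"
    proof (rule summable_steps_of_local_recursion[where p = "\<lambda>n. p (n + K)"])
      fix n
      assume "y (Suc n + K) \<in> ball xbar \<rho>"
      then show "2 * norm (y (Suc (Suc n) + K) - y (Suc n + K))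
          \<le> norm (y (Suc n + K) - y (n + K)) + p (n + K) - p (Suc n + K)"
        using recursion[of "n + K"] s_lt[of n] by (simp add: d_def)
    next
      fix n
      have "s (Suc (n + K)) \<in> {0..\<eta>}"
        using s_lt[of n] s_nonneg[of "Suc (n + K)"] by simp
      then have "0 \<le> \<psi> (s (Suc (n + K)))"
        using \<psi> by (auto simp: desingularizing_def)
      then show "0 \<le> p (n + K)"
        using \<open>0 < a\<close> \<open>0 < b\<close> by (simp add: p_def)
    next
      show "dist xbar (y (1 + K)) + norm (y (Suc 0 + K) - y (0 + K)) + p (0 + K) < \<rho>"
        using j(1) by (simp add: p_def d_def flip: K)
    qed
    then have "summable (\<lambda>n. d (n + K))"
      by (simp add: d_def)
    then show ?thesis
      by (simp add: summable_iff_shift)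
  qed
qed

theorem theorem1:
  fixes \<phi> :: "real ^ 'n \<Rightarrow> ereal" and a b :: real
    and x :: "nat \<Rightarrow> real ^ 'n" and xbar :: "real ^ 'n" and r :: "nat \<Rightarrow> nat"
  assumes "proper_fun \<phi>" and "lower_semicontinuous \<phi>" and "bounded_from_below \<phi>"
    and "a > 0" and "b > 0"
    and "sufficient_decrease \<phi> a x"
    and "relative_error \<phi> b x \<or> modified_relative_error \<phi> b x"
    and "xbar \<in> effective_domain \<phi>"
    and "strict_mono r" and "(\<lambda>j. x (r j)) \<longlonglongrightarrow> xbar"
    and "(\<lambda>j. \<phi> (x (r j))) \<longlonglongrightarrow> \<phi> xbar"
    and "basic_PLK \<phi> xbar"
  shows "summable (\<lambda>k. norm (x k - x (k + 1))) \<and> x \<longlonglongrightarrow> xbar \<and> M_stationary \<phi> xbar"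
proof -
  have not_minf: "\<phi> u \<noteq> -\<infinity>" for u
    using \<open>proper_fun \<phi>\<close> by (simp add: proper_fun_def)
  have "\<phi> xbar < \<infinity>"
    using \<open>xbar \<in> effective_domain \<phi>\<close> by (simp add: effective_domain_def)
  then obtain m where m: "\<phi> xbar = ereal m"
    using not_minf[of xbar] by (cases "\<phi> xbar") auto

  \<comment> \<open>The argument runs on the tail \<open>y\<close> that starts at a subsequence member \<open>x (r i)\<close> of finite
    value; \<open>i \<ge> 1\<close> ensures that the descent conditions hold along the whole tail.\<close>
  have "\<forall>\<^sub>F j in sequentially. \<phi> (x (r j)) < \<infinity>"
    using order_tendstoD(2)[OF assms(11) \<open>\<phi> xbar < \<infinity>\<close>] .
  then have "\<forall>\<^sub>F j in sequentially. \<phi> (x (r j)) < \<infinity> \<and> 1 \<le> j"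
    using eventually_ge_at_top by (rule eventually_conj)
  then obtain i where "\<phi> (x (r i)) < \<infinity>" and "1 \<le> i"
    using eventually_happens by fastforce
  define N where "N = r i"
  have "1 \<le> N"
    using seq_suble[OF \<open>strict_mono r\<close>, of i] \<open>1 \<le> i\<close> by (simp add: N_def)
  define y where "y n = x (n + N)" for n
  define d where "d n = norm (y (Suc n) - y n)" for n

  have decrease_ereal: "\<phi> (y (Suc n)) + ereal (a * (d n)\<^sup>2) \<le> \<phi> (y n)" for n
    using \<open>sufficient_decrease \<phi> a x\<close> \<open>1 \<le> N\<close>
    by (auto simp: sufficient_decrease_def y_def d_def)
  have "decseq (\<lambda>n. \<phi> (y n))"
  proof (rule decseq_SucI)
    fix n
    have "\<phi> (y (Suc n)) + 0 \<le> \<phi> (y (Suc n)) + ereal (a * (d n)\<^sup>2)"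
      using \<open>a > 0\<close> by (intro add_left_mono) simp
    with decrease_ereal[of n] show "\<phi> (y (Suc n)) \<le> \<phi> (y n)"
      by simp
  qed
  have finite: "\<bar>\<phi> (y n)\<bar> \<noteq> \<infinity>" for n
    using decseqD[OF \<open>decseq (\<lambda>n. \<phi> (y n))\<close>, of 0 n] \<open>\<phi> (x (r i)) < \<infinity>\<close> not_minf[of "y n"]
    by (auto simp: y_def N_def)

  define q where "q j = r (j + i) - N" for j
  have r_ge: "N \<le> r (j + i)" for j
    using strict_mono_less_eq[OF \<open>strict_mono r\<close>, of i "j + i"] by (simp add: N_def)
  have y_q: "y (q j) = x (r (j + i))" for j
    using r_ge[of j] by (simp add: y_def q_def)
  have "strict_mono q"
  proof (rule strict_monoI)
    fix j k :: nat
    assume "j < k"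
    then have "r (j + i) < r (k + i)"
      using \<open>strict_mono r\<close> by (simp add: strict_mono_less)
    then show "q j < q k"
      using r_ge[of j] by (simp add: q_def diff_less_mono)
  qed
  have q_lim: "(\<lambda>j. y (q j)) \<longlonglongrightarrow> xbar"
    unfolding y_q using assms(10) by (rule LIMSEQ_ignore_initial_segment)
  have "(\<lambda>j. \<phi> (y (q j))) \<longlonglongrightarrow> \<phi> xbar"
    unfolding y_q using assms(11) by (rule LIMSEQ_ignore_initial_segment)
  note phi_lim = decseq_subseq_limit[OF \<open>decseq (\<lambda>n. \<phi> (y n))\<close> \<open>strict_mono q\<close> this]

  define s where "s n = real_of_ereal (\<phi> (y n)) - m" for n
  have level: "\<phi> (y n) = ereal (m + s n)" for n
    using finite[of n] by (simp add: s_def ereal_real)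
  have "s n \<ge> 0" for n
    using phi_lim(2)[of n] by (simp add: m level)
  have decrease: "s (Suc n) + a * (d n)\<^sup>2 \<le> s n" for n
    using decrease_ereal[of n] by (simp add: level)
  have "(\<lambda>n. m + s n) \<longlonglongrightarrow> m"
    using phi_lim(1) by (simp add: m level)
  then have "s \<longlonglongrightarrow> 0"
    using tendsto_diff[OF _ tendsto_const, of "\<lambda>n. m + s n" m sequentially m] by simp

  have subgradient: "\<exists>w\<in>limiting_subdifferential \<phi> (y (Suc n)).
      \<exists>\<delta>. (\<delta> = d n \<or> \<delta> = d (Suc n)) \<and> norm w \<le> b * \<delta>" for n
    using assms(7)
  proof
    assume "relative_error \<phi> b x"
    then have "\<exists>w\<in>limiting_subdifferential \<phi> (x (n + N + 1)).
        norm w \<le> b * norm (x (n + N + 1) - x (n + N))"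
      unfolding relative_error_def using \<open>1 \<le> N\<close> trans_le_add2 by blast
    then obtain w where "w \<in> limiting_subdifferential \<phi> (y (Suc n))" "norm w \<le> b * d n"
      by (auto simp: y_def d_def)
    then show ?thesis by blast
  next
    assume "modified_relative_error \<phi> b x"
    then have "\<exists>w\<in>limiting_subdifferential \<phi> (x (Suc (n + N))).
        norm w \<le> b * norm (x (Suc (n + N) + 1) - x (Suc (n + N)))"
      unfolding modified_relative_error_def by (metis le_add1 plus_1_eq_Suc)
    then obtain w where "w \<in> limiting_subdifferential \<phi> (y (Suc n))" "norm w \<le> b * d (Suc n)"
      by (auto simp: y_def d_def)
    then show ?thesis by blast
  qed

  have "summable (\<lambda>n. norm (y (Suc n) - y n))"
    using decrease subgradient unfolding d_def
    by (intro descent_summable_steps[OF assms(12) \<open>a > 0\<close> \<open>b > 0\<close> m level _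
          \<open>\<And>n. s n \<ge> 0\<close> \<open>s \<longlonglongrightarrow> 0\<close> _ \<open>strict_mono q\<close> q_lim])
  then have "convergent y"
    by (rule convergent_if_summable_steps)
  then obtain l where "y \<longlonglongrightarrow> l"
    by (auto simp: convergent_def)
  then have "(\<lambda>j. y (q j)) \<longlonglongrightarrow> l"
    using LIMSEQ_subseq_LIMSEQ[OF _ \<open>strict_mono q\<close>] by (auto simp: o_def)
  then have "l = xbar"
    using q_lim by (rule LIMSEQ_unique)
  with \<open>y \<longlonglongrightarrow> l\<close> have "y \<longlonglongrightarrow> xbar"
    by simp

  have "d \<longlonglongrightarrow> 0"
    using summable_LIMSEQ_zero[OF \<open>summable (\<lambda>n. norm (y (Suc n) - y n))\<close>]
    by (simp add: d_def[abs_def])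
  obtain w where w: "\<And>n. w n \<in> limiting_subdifferential \<phi> (y (Suc n))"
    and "\<And>n. \<exists>\<delta>. (\<delta> = d n \<or> \<delta> = d (Suc n)) \<and> norm (w n) \<le> b * \<delta>"
    using subgradient by metis
  \<comment> \<open>The sum of the two steps dominates both possible error bounds.\<close>
  then have "norm (w n) \<le> b * (d n + d (Suc n))" for n
    using \<open>b > 0\<close> norm_ge_zero[of "y (Suc n) - y n"] norm_ge_zero[of "y (Suc (Suc n)) - y (Suc n)"]
    unfolding d_def by (smt (verit) mult_left_mono)
  moreover have "(\<lambda>n. b * (d n + d (Suc n))) \<longlonglongrightarrow> b * (0 + 0)"
    by (intro tendsto_mult_left tendsto_add \<open>d \<longlonglongrightarrow> 0\<close> LIMSEQ_Suc)
  then have "(\<lambda>n. b * (d n + d (Suc n))) \<longlonglongrightarrow> 0"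
    by simp
  ultimately have "w \<longlonglongrightarrow> 0"
    using Lim_null_comparison[OF always_eventually, of w "\<lambda>n. b * (d n + d (Suc n))"] by blast
  then have "0 \<in> limiting_subdifferential \<phi> xbar"
    using limiting_subdifferential_limit[OF \<open>xbar \<in> effective_domain \<phi>\<close>
        LIMSEQ_Suc[OF \<open>y \<longlonglongrightarrow> xbar\<close>] LIMSEQ_Suc[OF phi_lim(1)] _ w] by blast
  moreover have "x \<longlonglongrightarrow> xbar"
    using \<open>y \<longlonglongrightarrow> xbar\<close> unfolding y_def by (rule LIMSEQ_offset)
  moreover have "summable (\<lambda>k. norm (x k - x (k + 1)))"
  proof -
    have "summable (\<lambda>n. norm (x (n + N) - x (n + N + 1)))"
      using \<open>summable (\<lambda>n. norm (y (Suc n) - y n))\<close>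
      unfolding y_def by (subst norm_minus_commute) (simp only: add_Suc flip: Suc_eq_plus1)
    then show ?thesis
      by (rule summable_iff_shift[of "\<lambda>k. norm (x k - x (k + 1))" N, THEN iffD1])
  qed
  ultimately show ?thesis
    by (simp add: M_stationary_def)
qed

end
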